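(* Let $A$ be an ordered alphabet with an order-preserving involution and let $F$ be a final segment of $A^{\ast}$. The following conditions are equivalent: (1) $F$ is Ferrers; (2) the space $\mathcal{S}_F$ is linearly orderable.
   Context: $A$ is a partially ordered set with an order-preserving involution $a\mapsto\overline a$. $A^{\ast}$ is the free monoid of words over $A$; the involution extends by $\overline{a_0\cdots a_{n-1}}=\overline{a_{n-1}}\cdots\overline{a_0}$. $A^{\ast}$ carries the Higman ordering: $a_0\cdots a_{n-1}\le b_0\cdots b_{m-1}$ iff there is a strictly increasing map $h:\{0,\dots,n-1\}\to\{0,\dots,m-1\}$ with $a_i\le b_{h(i)}$ for all $i$. A final segment is an upward closed subset. A language $L\subseteq A^{\ast}$ is Ferrers if for all $x,x',y,y'\in A^{\ast}$: $xx'\in L$ and $yy'\in L$ imply $xy'\in L$ or $yx'\in L$. The set $\mathbf{F}(A^{\ast})$ of final segments of $A^{\ast}$ is ordered by reverse inclusion ($X\le Y$ iff $X\supseteq Y$). For $Y\subseteq A^{\ast}$, $FY^{-1}:=\{u\in A^{\ast}:uy\in F\text{ for all }y\in Y\}$; $\mathcal{S}_F:=\{FY^{-1}:Y\subseteq A^{\ast}\}$, with the $\mathbf{F}(A^{\ast})$-valued distance $d(p,q):=\{w\in A^{\ast}:pw\subseteq q\text{ and }q\overline w\subseteq p\}$. (This is a representation of the injective envelope of a two-element metric space over $\mathbf{F}(A^{\ast})$ whose elements are at distance $F$.) A metric space $(E,d)$ over $\mathbf{F}(A^{\ast})$ is linearly orderable if there is a linear order $\preceq$ on $E$ such that $d(x,z)\le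 d(x,y)$ and $d(z,y)\le d(x,y)$ (i.e. $d(x,z)\supseteq d(x,y)$ and $d(z,y)\supseteq d(x,y)$) for all $x,y,z\in E$ with $x\preceq z\preceq y$. *)

theory Defs
  imports "HOL-Library.Sublist"
begin

definition order_involution :: "('a::order \<Rightarrow> 'a) \<Rightarrow> bool" where
  "order_involution bar \<longleftrightarrow> mono bar \<and> (\<forall>a. bar (bar a) = a)"

definition word_bar :: "('a \<Rightarrow> 'a) \<Rightarrow> 'a list \<Rightarrow> 'a list" where
  "word_bar bar w = rev (map bar w)"

definition higman_le :: "'a::order list \<Rightarrow> 'a list \<Rightarrow> bool" where
  "higman_le u v \<longleftrightarrow>
    (\<exists>h. strict_mono_on {..<length u} h \<and>
         (\<forall>i<length u. h i < length v \<and> u ! i \<le> v ! h i))"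

lemma higman_le_iff_list_emb: "higman_le u v \<longleftrightarrow> list_emb (\<le>) u v"
proof
  assume "list_emb (\<le>) u v"
  then show "higman_le u v"
  proof induction
    case (list_emb_Nil ys)
    show ?case by (simp add: higman_le_def)
  next
    case (list_emb_Cons xs ys y)
    then obtain h where "strict_mono_on {..<length xs} h"
      and "\<forall>i<length xs. h i < length ys \<and> xs ! i \<le> ys ! h i"
      by (auto simp: higman_le_def)
    then show ?case unfolding higman_le_def
      by (intro exI[of _ "Suc \<circ> h"]) (auto simp: strict_mono_on_def)
  next
    case (list_emb_Cons2 x y xs ys)
    then obtain h where "strict_mono_on {..<length xs} h"
      and "\<forall>i<length xs. h i < length ys \<and> xs ! i \<le> ys ! h i"
      by (auto simp: higman_le_def)
    with list_emb_Cons2.hyps show ?case unfolding higman_le_def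
      by (intro exI[of _ "case_nat 0 (Suc \<circ> h)"])
        (auto simp: strict_mono_on_def less_Suc_eq_0_disj split: nat.splits)
  qed
next
  show "higman_le u v \<Longrightarrow> list_emb (\<le>) u v"
  proof (induction u arbitrary: v)
    case Nil
    show ?case by simp
  next
    case (Cons x xs)
    then obtain h where mono: "strict_mono_on {..<Suc (length xs)} h"
      and h: "\<And>i. i < Suc (length xs) \<Longrightarrow> h i < length v \<and> (x # xs) ! i \<le> v ! h i"
      by (auto simp: higman_le_def)
    let ?g = "\<lambda>i. h (Suc i) - Suc (h 0)"
    have less: "h i < h j" if "i < j" "j < Suc (length xs)" for i j
      using mono that by (auto simp: strict_mono_on_def)
    have "higman_le xs (drop (Suc (h 0)) v)"
      unfolding higman_le_def
    proof (intro exI[of _ ?g] conjI allI impI)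
      show "strict_mono_on {..<length xs} ?g"
      proof (rule strict_mono_onI)
        fix i j assume "i \<in> {..<length xs}" "j \<in> {..<length xs}" "i < j"
        then show "?g i < ?g j"
          using less[of 0 "Suc i"] less[of "Suc i" "Suc j"] by simp
      qed
    next
      fix i assume i: "i < length xs"
      then have "Suc (h 0) \<le> h (Suc i)" using less[of 0 "Suc i"] by simp
      then show "?g i < length (drop (Suc (h 0)) v)"
        and "xs ! i \<le> drop (Suc (h 0)) v ! ?g i"
        using h[of "Suc i"] i by auto
    qed
    then have "list_emb (\<le>) (x # xs) (v ! h 0 # drop (Suc (h 0)) v)"
      using h[of 0] Cons.IH by auto
    then have "list_emb (\<le>) (x # xs) (take (h 0) v @ v ! h 0 # drop (Suc (h 0)) v)"
      by (rule list_emb_append2)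
    then show ?case using h[of 0] by (simp add: id_take_nth_drop[symmetric])
  qed
qed

definition final_segment :: "'a::order list set \<Rightarrow> bool" where
  "final_segment F \<longleftrightarrow> (\<forall>u v. u \<in> F \<longrightarrow> higman_le u v \<longrightarrow> v \<in> F)"

definition ferrers :: "'a list set \<Rightarrow> bool" where
  "ferrers L \<longleftrightarrow>
    (\<forall>x x' y y'. x @ x' \<in> L \<longrightarrow> y @ y' \<in> L \<longrightarrow> x @ y' \<in> L \<or> y @ x' \<in> L)"

(* The quotient F Y^{-1}. *)
definition residual :: "'a list set \<Rightarrow> 'a list set \<Rightarrow> 'a list set" where
  "residual F Y = {u. \<forall>y\<in>Y. u @ y \<in> F}"

definition S_space :: "'a list set \<Rightarrow> 'a list set set" where
  "S_space F = {residual F Y | Y. True}"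

definition S_dist :: "('a \<Rightarrow> 'a) \<Rightarrow> 'a list set \<Rightarrow> 'a list set \<Rightarrow> 'a list set" where
  "S_dist bar p q =
    {w. (\<forall>u\<in>p. u @ w \<in> q) \<and> (\<forall>v\<in>q. v @ word_bar bar w \<in> p)}"

(* Distances are final segments, ordered by reverse inclusion: d x z is at most
   d x y when d x z contains d x y.  The carrier is E, so r is an order on E. *)
definition linearly_orderable :: "'e set \<Rightarrow> ('e \<Rightarrow> 'e \<Rightarrow> 'a list set) \<Rightarrow> bool" where
  "linearly_orderable E d \<longleftrightarrow>
    (\<exists>r. linear_order_on E r \<and>
      (\<forall>x\<in>E. \<forall>y\<in>E. \<forall>z\<in>E. (x, z) \<in> r \<longrightarrow> (z, y) \<in> r \<longrightarrow>
         d x z \<supseteq> d x y \<and> d z y \<supseteq> d x y))"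

text \<open>The following facts show that, for a final segment \<open>F\<close>, the set \<open>S_space F\<close> with
  \<open>S_dist bar\<close> is a metric space over the involutive ordered monoid of final segments: its
  neutral and least element is \<open>UNIV\<close>, its operation is concatenation of languages.\<close>

lemma final_segment_residual:
  assumes "final_segment F" shows "final_segment (residual F Y)"
  using assms unfolding final_segment_def residual_def higman_le_iff_list_emb
  by (blast intro: list_emb_append_mono list_emb_refl order_refl)

lemma final_segment_S_space:
  "final_segment F \<Longrightarrow> p \<in> S_space F \<Longrightarrow> final_segment p"
  by (auto simp: S_space_def final_segment_residual)

lemma word_bar_append [simp]: "word_bar bar (u @ v) = word_bar bar v @ word_bar bar u"
  by (simp add: word_bar_def)

lemma word_bar_word_bar:
  "order_involution bar \<Longrightarrow> word_bar bar (word_bar bar w) = w"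
  by (simp add: word_bar_def order_involution_def rev_map comp_def)

lemma higman_le_word_bar:
  assumes "order_involution bar" "higman_le u v"
  shows "higman_le (word_bar bar u) (word_bar bar v)"
proof -
  have "list_emb (\<le>) u v" using assms by (simp add: higman_le_iff_list_emb)
  then have "list_emb (\<le>) (word_bar bar u) (word_bar bar v)"
  proof induction
    case (list_emb_Nil ys)
    show ?case by (simp add: word_bar_def)
  next
    case (list_emb_Cons xs ys y)
    then show ?case by (simp add: word_bar_def list_emb_prefix)
  next
    case (list_emb_Cons2 x y xs ys)
    then have "list_emb (\<le>) [bar x] [bar y]"
      using assms(1) by (auto simp: order_involution_def dest: monoD)
    with list_emb_Cons2.IH show ?case
      by (simp add: word_bar_def list_emb_append_mono)
  qed
  then show ?thesis by (simp add: higman_le_iff_list_emb)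
qed

lemma final_segment_S_dist:
  assumes bar: "order_involution bar" and p: "final_segment p" and q: "final_segment q"
  shows "final_segment (S_dist bar p q)"
  unfolding final_segment_def
proof (intro allI impI)
  fix w w' assume w: "w \<in> S_dist bar p q" and le: "higman_le w w'"
  have app: "higman_le (u @ a) (u @ b)" if "higman_le a b" for u a b :: "'a list"
    using that unfolding higman_le_iff_list_emb
    by (blast intro: list_emb_append_mono list_emb_refl order_refl)
  show "w' \<in> S_dist bar p q"
    using w p q app[OF le] app[OF higman_le_word_bar[OF bar le]]
    unfolding S_dist_def final_segment_def by blast
qed

lemma S_dist_eq_UNIV_iff:
  assumes "final_segment p" "final_segment q"
  shows "S_dist bar p q = UNIV \<longleftrightarrow> p = q"
proof
  assume "S_dist bar p q = UNIV"
  then have "[] \<in> S_dist bar p q" by simp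
  then show "p = q" by (auto simp: S_dist_def word_bar_def)
next
  assume "p = q"
  then show "S_dist bar p q = UNIV"
    using assms unfolding S_dist_def final_segment_def higman_le_iff_list_emb
    by (blast intro: list_emb_prefix list_emb_refl order_refl)
qed

lemma S_dist_commute:
  assumes "order_involution bar"
  shows "S_dist bar q p = word_bar bar ` S_dist bar p q"
proof (intro set_eqI iffI)
  fix w assume "w \<in> S_dist bar q p"
  then have "word_bar bar w \<in> S_dist bar p q"
    using assms by (simp add: S_dist_def word_bar_word_bar)
  then show "w \<in> word_bar bar ` S_dist bar p q"
    using word_bar_word_bar[OF assms, of w] by (metis imageI)
qed (use assms in \<open>auto simp: S_dist_def word_bar_word_bar\<close>)

lemma S_dist_triangle:
  "u \<in> S_dist bar p q \<Longrightarrow> v \<in> S_dist bar q r \<Longrightarrow> u @ v \<in> S_dist bar p r"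
  by (auto simp: S_dist_def simp flip: append_assoc)

end

theory Submission
  imports Defs
begin

text \<open>The language \<open>F\<close> is Ferrers iff \<open>S_space F\<close> is a chain under inclusion, and inclusion then
  witnesses linear orderability.  Conversely, let a linear order be given.  The space has a largest
  element \<open>UNIV\<close> and a smallest element \<open>F\<close>, and \<open>S_dist bar UNIV p = p\<close>, so points on the same
  side of \<open>UNIV\<close> are comparable.  If \<open>UNIV\<close> lies between \<open>p\<close> and \<open>q\<close>, it also lies between
  \<open>F\<close> and one of them, say \<open>p = residual F Y\<close>; then \<open>Y \<subseteq> S_dist bar p F \<subseteq> S_dist bar UNIV F = F\<close>,
  which forces \<open>p = UNIV\<close>.\<close>

lemma final_segment_append:
  assumes "final_segment F" "u \<in> F"
  shows "u @ v \<in> F" "v @ u \<in> F"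
proof -
  have "list_emb (\<le>) u (u @ v)" "list_emb (\<le>) u (v @ u)"
    by (auto intro: list_emb_prefix list_emb_append2 list_emb_refl)
  then show "u @ v \<in> F" "v @ u \<in> F"
    using assms unfolding final_segment_def higman_le_iff_list_emb by blast+
qed

lemma residual_in_S_space: "residual F Y \<in> S_space F"
  by (auto simp: S_space_def)

lemma UNIV_in_S_space: "UNIV \<in> S_space F"
  using residual_in_S_space[of F "{}"] by (simp add: residual_def)

lemma self_in_S_space: "F \<in> S_space F"
  using residual_in_S_space[of F "{[]}"] by (simp add: residual_def)

lemma subset_S_space: "final_segment F \<Longrightarrow> p \<in> S_space F \<Longrightarrow> F \<subseteq> p"
  by (auto simp: S_space_def residual_def final_segment_append)

text \<open>The condition leading back into \<open>UNIV\<close> is void; the empty word shows that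
  the other one forces membership in \<open>p\<close>, and \<open>p\<close> absorbs arbitrary
  prefixes.\<close>

lemma S_dist_UNIV_left:
  assumes "final_segment p"
  shows "S_dist bar UNIV p = p"
proof
  show "S_dist bar UNIV p \<subseteq> p"
    unfolding S_dist_def by (auto dest: spec[of _ "[]"])
  show "p \<subseteq> S_dist bar UNIV p"
    using final_segment_append(2)[OF assms] by (simp add: S_dist_def subset_iff)
qed

lemma ferrers_iff_chain:
  "ferrers F \<longleftrightarrow> (\<forall>p\<in>S_space F. \<forall>q\<in>S_space F. p \<subseteq> q \<or> q \<subseteq> p)"
proof
  assume L: "ferrers F"
  show "\<forall>p\<in>S_space F. \<forall>q\<in>S_space F. p \<subseteq> q \<or> q \<subseteq> p"
  proof (rule ccontr)
    assume "\<not> ?thesis"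
    then obtain Y Z u v where "u \<in> residual F Y" "u \<notin> residual F Z"
      "v \<in> residual F Z" "v \<notin> residual F Y"
      by (auto simp: S_space_def)
    \<comment> \<open>Some \<open>z\<close> in \<open>Z\<close> has \<open>u @ z\<close> outside
      \<open>F\<close> and some \<open>y\<close> in \<open>Y\<close> has \<open>v @ y\<close>
      outside \<open>F\<close>, yet \<open>u @ y\<close> and \<open>v @ z\<close> lie in
      \<open>F\<close>.\<close>
    then show False
      using L unfolding ferrers_def residual_def by blast
  qed
next
  assume chain: "\<forall>p\<in>S_space F. \<forall>q\<in>S_space F. p \<subseteq> q \<or> q \<subseteq> p"
  show "ferrers F"
    unfolding ferrers_def
  proof (intro allI impI)
    fix x x' y y' assume "x @ x' \<in> F" "y @ y' \<in> F"
    \<comment> \<open>Here \<open>x\<close> lies in the first residual and \<open>y\<close> in the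
      second, so either inclusion swaps a suffix.\<close>
    moreover have "residual F {x'} \<subseteq> residual F {y'} \<or> residual F {y'} \<subseteq> residual F {x'}"
      using chain residual_in_S_space by blast
    ultimately show "x @ y' \<in> F \<or> y @ x' \<in> F"
      by (auto simp: residual_def)
  qed
qed

text \<open>Final segments absorb suffixes, so going from a smaller set to a larger one imposes
  nothing; the condition back from larger to smaller weakens as the two sets approach each
  other.\<close>

lemma S_dist_antimono_chain:
  assumes "final_segment x" "final_segment z" "x \<subseteq> z" "z \<subseteq> y"
  shows "S_dist bar x y \<subseteq> S_dist bar x z" "S_dist bar x y \<subseteq> S_dist bar z y"
  using assms(3,4) final_segment_append(1)[OF assms(1)] final_segment_append(1)[OF assms(2)]
  by (auto simp: S_dist_def)

lemma chain_imp_linearly_orderable: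
  assumes E: "\<And>p. p \<in> E \<Longrightarrow> final_segment p"
    and chain: "\<And>p q. p \<in> E \<Longrightarrow> q \<in> E \<Longrightarrow> p \<subseteq> q \<or> q \<subseteq> p"
  shows "linearly_orderable E (S_dist bar)"
  unfolding linearly_orderable_def
proof (intro exI conjI ballI impI)
  let ?r = "{(p, q). p \<in> E \<and> q \<in> E \<and> p \<subseteq> q}"
  show "linear_order_on E ?r"
    using chain
    by (auto simp: linear_order_on_def partial_order_on_def preorder_on_def refl_on_def
        total_on_def trans_def antisym_def)
  show "S_dist bar x y \<subseteq> S_dist bar x z" "S_dist bar x y \<subseteq> S_dist bar z y"
    if "(x, z) \<in> ?r" "(z, y) \<in> ?r" for x y z
    using that E S_dist_antimono_chain[of x z y bar] by simp_all
qed

lemma S_dist_self_subset_imp_UNIV: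
  assumes F: "final_segment F" and p: "p \<in> S_space F"
    and sub: "S_dist bar p F \<subseteq> F"
  shows "p = UNIV"
proof -
  obtain Y where Y: "p = residual F Y"
    using p by (auto simp: S_space_def)
  \<comment> \<open>Appending a word of \<open>Y\<close> takes \<open>p\<close> into
    \<open>F\<close> by definition; the way back is free, as \<open>F\<close> absorbs suffixes and
    lies in \<open>p\<close>.\<close>
  have "Y \<subseteq> S_dist bar p F"
    using subset_S_space[OF F p] final_segment_append(1)[OF F]
    by (auto simp: S_dist_def Y residual_def)
  then have "Y \<subseteq> F"
    using sub by blast
  then show ?thesis
    unfolding Y residual_def using final_segment_append(2)[OF F] by blast
qed

lemma linearly_orderable_imp_chain:
  assumes bar: "order_involution bar" and F: "final_segment F"
    and lin: "linearly_orderable (S_space F) (S_dist bar)"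
    and p: "p \<in> S_space F" and q: "q \<in> S_space F"
  shows "p \<subseteq> q \<or> q \<subseteq> p"
proof -
  obtain r where r: "linear_order_on (S_space F) r"
    and d: "\<And>x y z. x \<in> S_space F \<Longrightarrow> y \<in> S_space F \<Longrightarrow> z \<in> S_space F \<Longrightarrow>
      (x, z) \<in> r \<Longrightarrow> (z, y) \<in> r \<Longrightarrow>
      S_dist bar x y \<subseteq> S_dist bar x z \<and> S_dist bar x y \<subseteq> S_dist bar z y"
    using lin unfolding linearly_orderable_def by blast
  \<comment> \<open>Betweenness in either direction of \<open>r\<close>; the reversed direction
    reduces to the other because swapping the arguments of the distance takes its image under
    \<open>word_bar bar\<close>.\<close>
  define btw where "btw x z y \<longleftrightarrow> (x, z) \<in> r \<and> (z, y) \<in> r \<or> (y, z) \<in> r \<and> (z, x) \<in> r" for x y z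
  have btw_left: "S_dist bar x y \<subseteq> S_dist bar x z"
    and btw_right: "S_dist bar x y \<subseteq> S_dist bar z y"
    if "btw x z y" "x \<in> S_space F" "y \<in> S_space F" "z \<in> S_space F" for x y z
  proof -
    have "S_dist bar x y \<subseteq> S_dist bar x z \<and> S_dist bar x y \<subseteq> S_dist bar z y \<or>
      S_dist bar y x \<subseteq> S_dist bar z x \<and> S_dist bar y x \<subseteq> S_dist bar y z"
      using that d[of x y z] d[of y x z] unfolding btw_def by blast
    then show "S_dist bar x y \<subseteq> S_dist bar x z" "S_dist bar x y \<subseteq> S_dist bar z y"
      using S_dist_commute[OF bar, of x y] S_dist_commute[OF bar, of x z]
        S_dist_commute[OF bar, of z y]
      by auto
  qed
  have tot: "(x, y) \<in> r \<or> (y, x) \<in> r" if "x \<in> S_space F" "y \<in> S_space F" for x y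
    using r that
    by (cases "x = y")
      (auto simp: linear_order_on_def partial_order_on_def preorder_on_def refl_on_def total_on_def)
  have UNIV_left: "S_dist bar UNIV x = x" if "x \<in> S_space F" for x
    by (rule S_dist_UNIV_left[OF final_segment_S_space[OF F that]])
  have same_side: "y \<subseteq> x" if "btw UNIV x y" "x \<in> S_space F" "y \<in> S_space F" for x y
    using btw_left[OF that(1) UNIV_in_S_space that(3,2)] that by (simp add: UNIV_left)
  have beyond: "x = UNIV" if "btw x UNIV F" "x \<in> S_space F" for x
  proof (rule S_dist_self_subset_imp_UNIV[OF F that(2)])
    show "S_dist bar x F \<subseteq> F"
      using btw_right[OF that self_in_S_space UNIV_in_S_space]
      unfolding UNIV_left[OF self_in_S_space] .
  qed
  \<comment> \<open>If \<open>p\<close> and \<open>q\<close> lie on opposite sides of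
    \<open>UNIV\<close>, then \<open>F\<close> lies on one side, and \<open>UNIV\<close> separates
    it from whichever of \<open>p\<close>, \<open>q\<close> is on the other.\<close>
  consider "btw UNIV p q" | "btw UNIV q p" | "btw p UNIV F" | "btw q UNIV F"
    using tot[OF p q] tot[OF p UNIV_in_S_space] tot[OF q UNIV_in_S_space]
      tot[OF self_in_S_space UNIV_in_S_space]
    unfolding btw_def by blast
  then show ?thesis
    using same_side beyond p q by cases blast+
qed

theorem theorem23:
  fixes bar :: "'a::order \<Rightarrow> 'a" and F :: "'a list set"
  assumes "order_involution bar" and "final_segment F"
  shows "ferrers F \<longleftrightarrow> linearly_orderable (S_space F) (S_dist bar)"
  unfolding ferrers_iff_chain
proof
  assume chain: "\<forall>p\<in>S_space F. \<forall>q\<in>S_space F. p \<subseteq> q \<or> q \<subseteq> p"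
  show "linearly_orderable (S_space F) (S_dist bar)"
  proof (rule chain_imp_linearly_orderable)
    show "final_segment p" if "p \<in> S_space F" for p
      by (rule final_segment_S_space[OF assms(2) that])
    show "p \<subseteq> q \<or> q \<subseteq> p" if "p \<in> S_space F" "q \<in> S_space F" for p q
      using chain that by blast
  qed
next
  assume "linearly_orderable (S_space F) (S_dist bar)"
  then show "\<forall>p\<in>S_space F. \<forall>q\<in>S_space F. p \<subseteq> q \<or> q \<subseteq> p"
    by (intro ballI linearly_orderable_imp_chain[OF assms])
qed

end
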